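(* Let $f:\{0,1\}^\omega\to\{0,1\}^\omega$ be a total computable function with $\mu(f(\{0,1\}^\omega))>0$. Then $f$ has a $\emptyset'$-computable positive inversion, i.e. there is a partial $\emptyset'$-computable $g:\subseteq\{0,1\}^\omega\to\{0,1\}^\omega$ with $\mu(\{y: f(g(y))=y\})>0$.
   Context: Reals are elements of $\{0,1\}^\omega$ and $\mu$ is the uniform measure. $\emptyset'$ is the halting problem. For a real $w$, a partial function $g:\subseteq\{0,1\}^\omega\to\{0,1\}^\omega$ is partial $w$-computable if there is an oracle Turing functional $\Phi$ with access to the additional oracle $w$ such that for every $x$: $x\in\mathrm{dom}(g)$ iff $\Phi^{x\oplus w}(n)\downarrow$ for all $n$; and if $x\in\mathrm{dom}(g)$ then $\Phi^{x\oplus w}(n)=g(x)(n)$ for all $n$. Here $x\oplus w$ is the real $z$ with $z(2n)=x(n)$, $z(2n+1)=w(n)$. Total computable means computable without additional oracle and defined on all of $\{0,1\}^\omega$. The equation $f(g(y))=y$ includes the assertion that $g(y)$ is defined. *)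

theory Defs
  imports "HOL-Probability.Probability" "HOL-Library.Nat_Bijection"
begin

text \<open>The elements of Cantor space are 0-1-sequences; \<^term>\<open>True\<close> is the bit 1.\<close>

type_synonym cantor = "nat \<Rightarrow> bool"

definition cantor_measure :: "cantor measure" where
  "cantor_measure = PiM UNIV (\<lambda>_. measure_pmf (bernoulli_pmf (1/2)))"

definition join :: "cantor \<Rightarrow> cantor \<Rightarrow> cantor" (infixr "\<oplus>\<^sub>T" 65) where
  "(x \<oplus>\<^sub>T w) n = (if even n then x (n div 2) else w (n div 2))"

text \<open>Turing functionals are given by programs for Kleene's partial recursive functions
  relative to an oracle. A program is applied to a list of arguments and diverges on lists
  of an unsuitable length.\<close>

datatype prog =
    Zero
  | Succ
  | Proj nat
  | Oracle
  | Comp prog "prog list"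
  | Prec prog prog
  | Mu prog

text \<open>\<open>eval z p xs y\<close>: with oracle \<open>z\<close>, program \<open>p\<close> halts on the
  arguments \<open>xs\<close> with output \<open>y\<close>.\<close>

inductive eval :: "cantor \<Rightarrow> prog \<Rightarrow> nat list \<Rightarrow> nat \<Rightarrow> bool" for z :: cantor where
  Zero: "eval z Zero xs 0"
| Succ: "eval z Succ [n] (Suc n)"
| Proj: "i < length xs \<Longrightarrow> eval z (Proj i) xs (xs ! i)"
| Oracle: "eval z Oracle [n] (of_bool (z n))"
| Comp: "list_all2 (\<lambda>q y. eval z q xs y) qs ys \<Longrightarrow> eval z p ys k \<Longrightarrow> eval z (Comp p qs) xs k"
| Prec_0: "eval z p xs k \<Longrightarrow> eval z (Prec p q) (0 # xs) k"
| Prec_Suc: "eval z (Prec p q) (n # xs) r \<Longrightarrow> eval z q (n # r # xs) k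
    \<Longrightarrow> eval z (Prec p q) (Suc n # xs) k"
| Mu: "eval z p (n # xs) 0 \<Longrightarrow> (\<forall>m<n. \<exists>k. eval z p (m # xs) (Suc k)) \<Longrightarrow> eval z (Mu p) xs n"

definition halts :: "cantor \<Rightarrow> prog \<Rightarrow> nat list \<Rightarrow> bool" where
  "halts z p xs \<longleftrightarrow> (\<exists>k. eval z p xs k)"

lemma eval_deterministic: "eval z p xs k \<Longrightarrow> eval z p xs k' \<Longrightarrow> k = k'"
proof (induction arbitrary: k' rule: eval.induct)
  case (Comp xs qs ys p k)
  from Comp.prems obtain ys' where ys': "list_all2 (\<lambda>q y. eval z q xs y) qs ys'" "eval z p ys' k'"
    by (cases rule: eval.cases) auto
  have "ys = ys'"
    using Comp.IH(1) ys'(1) by (auto simp: list_all2_conv_all_nth intro!: nth_equalityI)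
  then show ?case using Comp.IH(2) ys'(2) by simp
next
  case (Mu p n xs)
  from Mu.prems have k': "eval z p (k' # xs) 0" "\<forall>m<k'. \<exists>k. eval z p (m # xs) (Suc k)"
    by (cases rule: eval.cases; simp)+
  show ?case
  proof (rule linorder_cases[of n k'])
    assume "n < k'"
    then show ?thesis using k'(2) Mu.IH by fastforce
  next
    assume "k' < n"
    then show ?thesis using k'(1) Mu.IH by fastforce
  qed
next
  case (Prec_Suc p q n xs r k)
  from Prec_Suc.prems obtain r' where "eval z (Prec p q) (n # xs) r'" "eval z q (n # r' # xs) k'"
    by (cases rule: eval.cases) auto
  then show ?case using Prec_Suc.IH by blast
next
  case (Prec_0 p xs k q)
  from Prec_0.prems have "eval z p xs k'" by (cases rule: eval.cases) auto
  then show ?case by (rule Prec_0.IH)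
qed (erule eval.cases; simp)+

text \<open>An effective Goedel numbering of programs, spelled out because an arbitrary injection
  into the natural numbers would not determine the degree of the halting problem.\<close>

primrec code :: "prog \<Rightarrow> nat" where
  "code Zero = prod_encode (0, 0)"
| "code Succ = prod_encode (1, 0)"
| "code (Proj i) = prod_encode (2, i)"
| "code Oracle = prod_encode (3, 0)"
| "code (Comp p qs) = prod_encode (4, prod_encode (code p, list_encode (map code qs)))"
| "code (Prec p q) = prod_encode (5, prod_encode (code p, code q))"
| "code (Mu p) = prod_encode (6, code p)"

lemma code_inject: "code p = code q \<Longrightarrow> p = q"
proof (induction p arbitrary: q)
  case (Comp p ps)
  then obtain p' ps' where q: "q = Comp p' ps'" "code p = code p'" "map code ps = map code ps'"
    by (cases q) (auto simp: list_encode_eq)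
  moreover have "ps = ps'"
    using q(3) Comp.IH(2) by (metis list.inj_map_strong)
  ultimately show ?case using Comp.IH(1) by simp
next
  case (Prec p1 p2)
  then show ?case by (cases q) auto
next
  case (Mu p)
  then show ?case by (cases q) auto
next
  case Zero
  then show ?case by (cases q) auto
next
  case Succ
  then show ?case by (cases q) auto
next
  case (Proj i)
  then show ?case by (cases q) auto
next
  case Oracle
  then show ?case by (cases q) auto
qed

text \<open>The halting problem, as the set of all pairs of a program and an input on which the
  program halts with the empty oracle.\<close>

definition halting_problem :: cantor where
  "halting_problem m \<longleftrightarrow> (\<exists>p n. m = prod_encode (code p, n) \<and> halts (\<lambda>_. False) p [n])"

definition partial_computable_in :: "cantor \<Rightarrow> (cantor \<rightharpoonup> cantor) \<Rightarrow> bool" where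
  "partial_computable_in w g \<longleftrightarrow> (\<exists>p. \<forall>x.
     (x \<in> dom g \<longleftrightarrow> (\<forall>n. halts (x \<oplus>\<^sub>T w) p [n])) \<and>
     (\<forall>y. g x = Some y \<longrightarrow> (\<forall>n. eval (x \<oplus>\<^sub>T w) p [n] (of_bool (y n)))))"

definition total_computable :: "(cantor \<Rightarrow> cantor) \<Rightarrow> bool" where
  "total_computable f \<longleftrightarrow> (\<exists>p. \<forall>x n. eval x p [n] (of_bool (f x n)))"

end

theory Submission
  imports Defs
begin

text \<open>The leftmost preimage of \<open>y\<close> under \<open>f\<close> can be followed bit by bit once one can decide, for a
  string \<open>s\<close>, whether \<open>y\<close> lies in the closed set \<open>f([s])\<close>, where \<open>[s]\<close> is the set of all
  sequences that extend \<open>s\<close>. This is a co-enumerable question about \<open>y\<close>, so the natural oracle for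
  it is the jump of \<open>y\<close>. The halting problem alone is enough if a few \<open>y\<close> may be treated wrongly:
  \<open>f([s])\<close> is the intersection of a decreasing computable sequence of clopen sets (\<open>stage\<close> below),
  and the halting problem can find, for every length \<open>l\<close>, a number \<open>settled l\<close> such that the
  stages with that number exceed their limits, over all strings \<open>s\<close> of length \<open>l\<close> together, by
  measure at most \<open>2 ^ -(l + c)\<close>. To say that a stage is settled is to say that no other
  stage has a total measure smaller by that much. The measures are rationals which
  are computed by counting strings, so this is a purely universal statement about natural numbers.

  The inversion then trusts the settled stages in place of their limits. It is total, and it is
  right on every \<open>y\<close> in the range of \<open>f\<close> outside the union of the error sets
  (\<open>inversion_correct\<close>). That union has measure at most \<open>2 ^ (1 - c)\<close>
  (\<open>measure_UN_bad_le\<close>), which is smaller than the measure of the range of \<open>f\<close> when \<open>c\<close> is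
  large. The constant \<open>c\<close> is not computed from \<open>f\<close>; the theorem only claims that an inversion
  exists.

  The stages are computable because of the use of a computation, the bound below which it queries
  the oracle. The use is itself computed by a program relative to the same oracle
  (\<open>use_principle\<close>). Since Cantor space is compact, the use of \<open>f\<close> at a given position is bounded
  (\<open>locally_constant_bounded\<close>), and such a bound is found by trying all finite oracles, that is,
  by running programs in which the oracle is replaced by a finite string given as a number
  (\<open>computable_from_finite_oracle\<close>).\<close>

section \<open>Closure properties of the computable functions\<close>

text \<open>The arguments of a function are the values \<open>e 0, \<dots>, e (a - 1)\<close> of an environment. With
  environments in place of argument lists the closure properties below can be used as introduction
  rules: binding a variable shifts the environment, and the shift disappears by beta reduction.
  The function may depend on the oracle, for which a single program must work throughout \<open>Z\<close>. With
  \<open>Z = UNIV\<close> this is uniform relative computability; a smaller \<open>Z\<close> allows a search that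
  terminates for certain oracles only.\<close>
definition computable :: "cantor set \<Rightarrow> nat \<Rightarrow> (cantor \<Rightarrow> (nat \<Rightarrow> nat) \<Rightarrow> nat) \<Rightarrow> bool" where
  "computable Z a F \<longleftrightarrow> (\<exists>p. \<forall>z\<in>Z. \<forall>e. eval z p (map e [0..<a]) (F z e))"

abbreviation decidable :: "cantor set \<Rightarrow> nat \<Rightarrow> (cantor \<Rightarrow> (nat \<Rightarrow> nat) \<Rightarrow> bool) \<Rightarrow> bool" where
  "decidable Z a P \<equiv> computable Z a (\<lambda>z e. of_bool (P z e))"

lemma map_upt_Suc: "map e [0..<Suc a] = e 0 # map (\<lambda>j. e (Suc j)) [0..<a]"
  by (rule nth_equalityI) (auto simp: nth_Cons' simp del: upt_Suc)

lemma computable_compose: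
  assumes "computable Z b F" and "\<forall>i<b. computable Z a (G i)"
  shows "computable Z a (\<lambda>z e. F z (\<lambda>i. G i z e))"
proof -
  from assms(1) obtain p where p: "\<And>z e. z \<in> Z \<Longrightarrow> eval z p (map e [0..<b]) (F z e)"
    unfolding computable_def by blast
  from assms(2) obtain q where
    q: "\<And>i z e. i < b \<Longrightarrow> z \<in> Z \<Longrightarrow> eval z (q i) (map e [0..<a]) (G i z e)"
    unfolding computable_def by metis
  have "eval z (Comp p (map q [0..<b])) (map e [0..<a]) (F z (\<lambda>i. G i z e))" if "z \<in> Z" for z e
    by (rule eval.Comp[OF _ p[OF that, of "\<lambda>i. G i z e"]])
      (use that in \<open>simp add: list_all2_conv_all_nth q\<close>)
  then show ?thesis unfolding computable_def by blast
qed

lemma computable_compose1: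
  assumes "computable Z 1 (\<lambda>z e. F z (e 0))" "computable Z a A"
  shows "computable Z a (\<lambda>z e. F z (A z e))"
  by (rule computable_compose[OF assms(1), where G = "\<lambda>_. A"]) (simp add: assms(2))

lemma computable_compose2:
  assumes "computable Z 2 (\<lambda>z e. F z (e 0) (e 1))" "computable Z a A" "computable Z a B"
  shows "computable Z a (\<lambda>z e. F z (A z e) (B z e))"
  using computable_compose[OF assms(1), where G = "\<lambda>i. [A, B] ! i" and a = a] assms(2,3)
  by (simp add: All_less_Suc2 numeral_eq_Suc)

lemma computable_compose3:
  assumes "computable Z 3 (\<lambda>z e. F z (e 0) (e 1) (e 2))"
    and "computable Z a A" "computable Z a B" "computable Z a C"
  shows "computable Z a (\<lambda>z e. F z (A z e) (B z e) (C z e))"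
  using computable_compose[OF assms(1), where G = "\<lambda>i. [A, B, C] ! i" and a = a] assms(2-)
  by (simp add: All_less_Suc2 numeral_eq_Suc)

lemma computable_compose4:
  assumes "computable Z 4 (\<lambda>z e. F z (e 0) (e 1) (e 2) (e 3))"
    and "computable Z a A" "computable Z a B" "computable Z a C" "computable Z a D"
  shows "computable Z a (\<lambda>z e. F z (A z e) (B z e) (C z e) (D z e))"
  using computable_compose[OF assms(1), where G = "\<lambda>i. [A, B, C, D] ! i" and a = a] assms(2-)
  by (simp add: All_less_Suc2 numeral_eq_Suc)

lemma computable_arg: "i < a \<Longrightarrow> computable Z a (\<lambda>z e. e i)"
  unfolding computable_def
  using eval.Proj[of i "map _ [0..<a]"] by (intro exI[of _ "Proj i"]) fastforce

lemma computable_Suc: "computable Z a F \<Longrightarrow> computable Z a (\<lambda>z e. Suc (F z e))"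
  by (rule computable_compose1) (auto simp: computable_def intro!: exI[of _ Succ] eval.Succ)

lemma computable_const: "computable Z a (\<lambda>z e. c)"
proof (induction c)
  case 0
  then show ?case unfolding computable_def using eval.Zero by blast
next
  case (Suc c)
  then show ?case by (rule computable_Suc)
qed

text \<open>Primitive recursion, and with it every numerical function that the proof uses.\<close>
lemma computable_rec_nat:
  assumes "computable Z a B" "computable Z a N"
    and "computable Z (Suc (Suc a)) (\<lambda>z e. S z (e 0) (e 1) (\<lambda>j. e (Suc (Suc j))))"
  shows "computable Z a (\<lambda>z e. rec_nat (B z e) (\<lambda>n r. S z n r e) (N z e))"
proof -
  from assms(1) obtain p where p: "\<And>z e. z \<in> Z \<Longrightarrow> eval z p (map e [0..<a]) (B z e)"
    unfolding computable_def by blast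
  from assms(3) obtain q where q: "\<And>z e. z \<in> Z \<Longrightarrow>
      eval z q (map e [0..<Suc (Suc a)]) (S z (e 0) (e 1) (\<lambda>j. e (Suc (Suc j))))"
    unfolding computable_def by blast
  have q': "eval z q (n # r # map e [0..<a]) (S z n r e)" if "z \<in> Z" for z n r e
    using q[OF that, of "case_nat n (case_nat r e)"] by (simp add: map_upt_Suc del: upt_Suc)
  have rec: "eval z (Prec p q) (n # map e [0..<a]) (rec_nat (B z e) (\<lambda>n r. S z n r e) n)"
    if "z \<in> Z" for z e n
    by (induction n) (auto intro: eval.intros p q' that)
  have "computable Z (Suc a) (\<lambda>z e. rec_nat (B z (\<lambda>j. e (Suc j)))
      (\<lambda>n r. S z n r (\<lambda>j. e (Suc j))) (e 0))"
    unfolding computable_def map_upt_Suc using rec by blast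
  from computable_compose[OF this, where G = "case_nat N (\<lambda>j z e. e j)" and a = a] assms(2)
  show ?thesis by (simp add: All_less_Suc2 computable_arg)
qed

lemma computable_Least:
  assumes "decidable Z (Suc a) (\<lambda>z e. P z (e 0) (\<lambda>j. e (Suc j)))"
    and ex: "\<And>z e. z \<in> Z \<Longrightarrow> \<exists>n. P z n e"
  shows "computable Z a (\<lambda>z e. LEAST n. P z n e)"
proof -
  \<comment> \<open>Minimisation stops at the value 0, so the characteristic function has to be negated.\<close>
  have "computable Z 1 (\<lambda>z e. rec_nat 1 (\<lambda>_ _. 0) (e 0))"
    by (intro computable_rec_nat computable_const computable_arg) simp_all
  from computable_compose1[OF this assms(1)]
  obtain p where p: "\<And>z e. z \<in> Z \<Longrightarrow> eval z p (map e [0..<Suc a])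
      (rec_nat 1 (\<lambda>_ _. 0) (of_bool (P z (e 0) (\<lambda>j. e (Suc j)))))"
    unfolding computable_def by blast
  have p': "eval z p (n # map e [0..<a]) (of_bool (\<not> P z n e))" if "z \<in> Z" for z n e
    using p[OF that, of "case_nat n e"] by (cases "P z n e") (simp_all add: map_upt_Suc del: upt_Suc)
  have "eval z (Mu p) (map e [0..<a]) (LEAST n. P z n e)" if z: "z \<in> Z" for z e
  proof (rule eval.Mu)
    show "eval z p ((LEAST n. P z n e) # map e [0..<a]) 0"
      using p'[OF z, of "LEAST n. P z n e" e] LeastI_ex[OF ex[OF z]] by simp
    show "\<forall>m<LEAST n. P z n e. \<exists>k. eval z p (m # map e [0..<a]) (Suc k)"
      using p'[OF z, of _ e] not_less_Least[of _ "\<lambda>n. P z n e"] by (metis One_nat_def of_bool_eq(2))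
  qed
  then show ?thesis unfolding computable_def by blast
qed

lemma computable_add:
  assumes "computable Z a F" "computable Z a G"
  shows "computable Z a (\<lambda>z e. F z e + G z e)"
proof -
  have "rec_nat m (\<lambda>_ r. Suc r) n = m + n" for m n :: nat
    by (induction n) auto
  moreover have "computable Z a (\<lambda>z e. rec_nat (F z e) (\<lambda>_ r. Suc r) (G z e))"
    by (intro computable_rec_nat computable_Suc computable_arg assms) simp
  ultimately show ?thesis by simp
qed

lemma computable_diff:
  assumes "computable Z a F" "computable Z a G"
  shows "computable Z a (\<lambda>z e. F z e - G z e)"
proof -
  have "rec_nat 0 (\<lambda>k _. k) n = n - 1" for n :: nat
    by (cases n) auto
  moreover have "computable Z 1 (\<lambda>z e. rec_nat 0 (\<lambda>k _. k) (e 0))"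
    by (intro computable_rec_nat computable_const computable_arg) simp_all
  ultimately have pred: "computable Z 1 (\<lambda>z e. e 0 - 1)" by simp
  have "rec_nat m (\<lambda>_ r. r - 1) n = m - n" for m n :: nat
    by (induction n) auto
  moreover have "computable Z a (\<lambda>z e. rec_nat (F z e) (\<lambda>_ r. r - 1) (G z e))"
    by (intro computable_rec_nat computable_compose1[OF pred] computable_arg assms) simp
  ultimately show ?thesis by simp
qed

lemma computable_sum:
  assumes "computable Z (Suc a) (\<lambda>z e. F z (e 0) (\<lambda>j. e (Suc j)))" "computable Z a N"
  shows "computable Z a (\<lambda>z e. \<Sum>i<N z e. F z i e)"
proof -
  have "rec_nat 0 (\<lambda>i r. r + h i) n = (\<Sum>i<n. h i)" for h :: "nat \<Rightarrow> nat" and n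
    by (induction n) auto
  moreover have "computable Z a (\<lambda>z e. rec_nat 0 (\<lambda>i r. r + F z i e) (N z e))"
  proof (intro computable_rec_nat computable_add computable_const computable_arg assms)
    show "computable Z (Suc (Suc a)) (\<lambda>z e. F z (e 0) (\<lambda>j. e (Suc (Suc j))))"
      using computable_compose[OF assms(1), where G = "case_nat (\<lambda>z e. e 0) (\<lambda>j z e. e (Suc (Suc j)))"
          and a = "Suc (Suc a)"]
      by (simp add: All_less_Suc2 computable_arg)
  qed simp
  ultimately show ?thesis by simp
qed

lemma computable_mult:
  assumes "computable Z a F" "computable Z a G"
  shows "computable Z a (\<lambda>z e. F z e * G z e)"
proof -
  have "computable Z 2 (\<lambda>z e. \<Sum>i<e 0. e 1)"
    by (intro computable_sum computable_arg) simp_all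
  from computable_compose2[OF this assms] show ?thesis by simp
qed

lemma computable_power2:
  assumes "computable Z a F"
  shows "computable Z a (\<lambda>z e. 2 ^ F z e)"
proof -
  have "rec_nat 1 (\<lambda>_ r. r * 2) n = (2::nat) ^ n" for n :: nat
    by (induction n) auto
  moreover have "computable Z a (\<lambda>z e. rec_nat 1 (\<lambda>_ r. r * 2) (F z e))"
    by (intro computable_rec_nat computable_mult computable_const computable_arg assms) simp
  ultimately show ?thesis by simp
qed

lemma decidable_not: "decidable Z a P \<Longrightarrow> decidable Z a (\<lambda>z e. \<not> P z e)"
proof -
  assume "decidable Z a P"
  then have "computable Z a (\<lambda>z e. 1 - of_bool (P z e))"
    by (intro computable_diff computable_const)
  moreover have "(1::nat) - of_bool p = of_bool (\<not> p)" for p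
    by simp
  ultimately show ?thesis by simp
qed

lemma decidable_and:
  "decidable Z a P \<Longrightarrow> decidable Z a Q \<Longrightarrow> decidable Z a (\<lambda>z e. P z e \<and> Q z e)"
  using computable_mult by (simp add: of_bool_conj)

lemma decidable_le:
  assumes "computable Z a F" "computable Z a G"
  shows "decidable Z a (\<lambda>z e. F z e \<le> G z e)"
proof -
  have "computable Z a (\<lambda>z e. 1 - (F z e - G z e))"
    by (intro computable_diff computable_const assms)
  moreover have "1 - (m - n) = of_bool (m \<le> n)" for m n :: nat
    by auto
  ultimately show ?thesis by simp
qed

lemma decidable_eq:
  "computable Z a F \<Longrightarrow> computable Z a G \<Longrightarrow> decidable Z a (\<lambda>z e. F z e = G z e)"
  unfolding eq_iff[of "_ :: nat"] by (intro decidable_and decidable_le)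

lemma computable_if:
  assumes "decidable Z a P" "computable Z a F" "computable Z a G"
  shows "computable Z a (\<lambda>z e. if P z e then F z e else G z e)"
proof -
  have "computable Z a (\<lambda>z e. of_bool (P z e) * F z e + of_bool (\<not> P z e) * G z e)"
    by (intro computable_add computable_mult decidable_not assms)
  moreover have "(\<lambda>z e. of_bool (P z e) * F z e + of_bool (\<not> P z e) * G z e)
      = (\<lambda>z e. if P z e then F z e else G z e)"
    by (simp add: fun_eq_iff)
  ultimately show ?thesis by simp
qed

lemma decidable_bex:
  assumes "decidable Z (Suc a) (\<lambda>z e. P z (e 0) (\<lambda>j. e (Suc j)))" "computable Z a N"
  shows "decidable Z a (\<lambda>z e. \<exists>i<N z e. P z i e)"
proof -
  have "decidable Z a (\<lambda>z e. (1::nat) \<le> (\<Sum>i<N z e. of_bool (P z i e)))"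
    by (intro decidable_le computable_sum computable_const assms)
  moreover have "(1::nat) \<le> (\<Sum>i<n. of_bool (Q i)) \<longleftrightarrow> (\<exists>i<n. Q i)" for n :: nat and Q
  proof -
    have "(\<Sum>i<n. of_bool (Q i)) = (0::nat) \<longleftrightarrow> \<not> (\<exists>i<n. Q i)"
      by (auto simp: sum_eq_0_iff)
    then show ?thesis by (metis less_one not_le)
  qed
  ultimately show ?thesis by simp
qed

lemma decidable_ball:
  assumes "decidable Z (Suc a) (\<lambda>z e. P z (e 0) (\<lambda>j. e (Suc j)))" "computable Z a N"
  shows "decidable Z a (\<lambda>z e. \<forall>i<N z e. P z i e)"
  using decidable_not[OF decidable_bex[OF decidable_not[OF assms(1)] assms(2)]] by simp

text \<open>A quotient is the number of positive multiples of the divisor up to the dividend, which is a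
  bounded sum.\<close>
lemma computable_div:
  assumes "computable Z a F" "computable Z a G" and pos: "\<And>z e. G z e > 0"
  shows "computable Z a (\<lambda>z e. F z e div G z e)"
proof -
  have "computable Z 2 (\<lambda>z e. \<Sum>k<e 0. of_bool (Suc k * e 1 \<le> e 0))"
    by (intro computable_sum decidable_le computable_mult computable_Suc computable_arg) simp_all
  from computable_compose2[OF this assms(1,2)]
  have "computable Z a (\<lambda>z e. \<Sum>k<F z e. of_bool (Suc k * G z e \<le> F z e))" .
  moreover have "(\<Sum>k<m. of_bool (Suc k * d \<le> m)) = m div d" if "d > 0" for m d :: nat
  proof -
    have "(\<Sum>k<m. of_bool (Suc k * d \<le> m)) = card {k. k < m \<and> Suc k * d \<le> m}"
      by (subst sum_of_bool_eq) (auto simp: Collect_conj_eq lessThan_def)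
    also have "{k. k < m \<and> Suc k * d \<le> m} = {..<m div d}"
    proof (rule set_eqI)
      fix k
      have "Suc k * d \<le> m \<longleftrightarrow> k < m div d"
        using less_eq_div_iff_mult_less_eq[OF that] by (simp add: Suc_le_eq[symmetric] del: mult_Suc)
      moreover have "k < m" if "k < m div d"
        using that div_le_dividend[of m d] by linarith
      ultimately show "k \<in> {k. k < m \<and> Suc k * d \<le> m} \<longleftrightarrow> k \<in> {..<m div d}"
        by auto
    qed
    finally show ?thesis by simp
  qed
  ultimately show ?thesis using pos by simp
qed

lemma computable_take_bit:
  "computable Z a F \<Longrightarrow> computable Z a G \<Longrightarrow> computable Z a (\<lambda>z e. take_bit (F z e) (G z e))"
  unfolding take_bit_eq_mod modulo_nat_def
  by (intro computable_diff computable_mult computable_div computable_power2) simp_all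

lemma decidable_bit:
  assumes "computable Z a F" "computable Z a G"
  shows "decidable Z a (\<lambda>z e. bit (F z e) (G z e))"
proof -
  have "computable Z 1 (\<lambda>z e. of_bool (\<exists>k<e 0. e 0 = Suc (2 * k)))"
    by (intro decidable_bex decidable_eq computable_Suc computable_mult computable_const
        computable_arg) simp_all
  moreover have "(\<exists>k<n. n = Suc (2 * k)) \<longleftrightarrow> odd n" for n :: nat
    by (auto elim!: oddE)
  ultimately have "computable Z 1 (\<lambda>z e. of_bool (odd (e 0)))" by simp
  then have "computable Z a (\<lambda>z e. of_bool (odd (F z e div 2 ^ G z e)))"
    by (rule computable_compose1) (intro computable_div computable_power2 assms, simp)
  then show ?thesis by (simp add: bit_iff_odd)
qed

lemma computable_prod_encode:
  assumes "computable Z a F" "computable Z a G"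
  shows "computable Z a (\<lambda>z e. prod_encode (F z e, G z e))"
  unfolding prod_encode_def triangle_def prod.case
  by (intro computable_add computable_div computable_mult computable_Suc computable_const assms) simp

lemmas computable_intros = computable_arg computable_const computable_Suc computable_add
  computable_diff computable_mult computable_power2 computable_sum computable_if
  computable_take_bit computable_prod_encode
  decidable_not decidable_and decidable_le decidable_eq decidable_bex decidable_ball decidable_bit

lemma decidable_oracle:
  assumes "computable Z a F"
  shows "decidable Z a (\<lambda>z e. z (F z e))"
proof (rule computable_compose1[OF _ assms])
  show "computable Z 1 (\<lambda>z e. of_bool (z (e 0)))"
  proof -
    have "eval z Oracle (map e [0..<1]) (of_bool (z (e 0)))" for z e
      using eval.Oracle[of z "e 0"] by simp
    then show ?thesis unfolding computable_def by blast
  qed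
qed

section \<open>Existential questions to the halting problem\<close>

text \<open>A question \<open>\<exists>t. Q t i j\<close> with a decidable \<open>Q\<close> asks whether one fixed program, the search for
  \<open>t\<close>, halts on the code of \<open>(i, j)\<close>. The code of that program is a constant of the query.\<close>
lemma decidable_ex_in_halting_problem:
  assumes Q: "decidable UNIV 3 (\<lambda>z e. Q (e 0) (e 1) (e 2))"
    and F: "computable Z a F" and G: "computable Z a G"
    and Z: "Z = range (\<lambda>y. y \<oplus>\<^sub>T halting_problem)"
  shows "decidable Z a (\<lambda>z e. \<exists>t. Q t (F z e) (G z e))"
proof -
  \<comment> \<open>The pair is decoded by a bounded search, so that only the pairing function itself has to
    be computable.\<close>
  define R where "R v t \<longleftrightarrow> (\<exists>i<Suc v. \<exists>j<Suc v. prod_encode (i, j) = v \<and> Q t i j)" for v t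
  have R_encode: "R (prod_encode (i, j)) t \<longleftrightarrow> Q t i j" for i j t
    unfolding R_def using le_prod_encode_1[of i j] le_prod_encode_2[of j i]
    by (auto simp: prod_encode_eq less_Suc_eq_le)
  note Q' = computable_compose3[where F = "\<lambda>z t i j. of_bool (Q t i j)", OF Q]
  have "decidable UNIV 2 (\<lambda>z e. \<not> R (e 1) (e 0))"
    unfolding R_def by (intro computable_intros Q') simp_all
  then obtain p where p: "\<And>z e. eval z p (map e [0..<2]) (of_bool (\<not> R (e 1) (e 0)))"
    unfolding computable_def by blast
  have p': "eval z p [t, v] (of_bool (\<not> R v t))" for z t v
    using p[of z "case_nat t (\<lambda>_. v)"] by (simp add: upt_rec)
  have halts: "halts z (Mu p) [v] \<longleftrightarrow> (\<exists>t. R v t)" for z v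
  proof
    assume "halts z (Mu p) [v]"
    then obtain t where "eval z (Mu p) [v] t" unfolding halts_def by blast
    then have "eval z p [t, v] 0" by (cases rule: eval.cases) auto
    with p'[of z t v] have "of_bool (\<not> R v t) = (0::nat)" by (rule eval_deterministic)
    then show "\<exists>t. R v t" by auto
  next
    assume ex: "\<exists>t. R v t"
    have "eval z (Mu p) [v] (LEAST t. R v t)"
    proof (rule eval.Mu)
      show "eval z p [LEAST t. R v t, v] 0"
        using p'[of z "LEAST t. R v t" v] LeastI_ex[OF ex] by simp
      show "\<forall>m<LEAST t. R v t. \<exists>k. eval z p [m, v] (Suc k)"
        using p'[of z _ v] not_less_Least[of _ "R v"] by (metis One_nat_def of_bool_eq(2))
    qed
    then show "halts z (Mu p) [v]" unfolding halts_def by blast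
  qed
  have query: "halting_problem (prod_encode (code (Mu p), v)) \<longleftrightarrow> (\<exists>t. R v t)" for v
  proof
    assume "halting_problem (prod_encode (code (Mu p), v))"
    then obtain q n where "prod_encode (code (Mu p), v) = prod_encode (code q, n)"
      and h: "halts (\<lambda>_. False) q [n]"
      unfolding halting_problem_def by blast
    then have "q = Mu p" "n = v"
      using code_inject by (metis prod_encode_eq prod.inject)+
    with h halts show "\<exists>t. R v t" by simp
  next
    assume "\<exists>t. R v t"
    then show "halting_problem (prod_encode (code (Mu p), v))"
      unfolding halting_problem_def using halts by blast
  qed
  have "decidable Z a (\<lambda>z e. z (Suc (2 * prod_encode (code (Mu p), prod_encode (F z e, G z e)))))"
    by (intro computable_intros decidable_oracle F G)
  moreover have "z (Suc (2 * prod_encode (code (Mu p), prod_encode (i, j)))) \<longleftrightarrow> (\<exists>t. Q t i j)"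
    if "z \<in> Z" for z i j
    using that query[of "prod_encode (i, j)"] by (auto simp: Z join_def R_encode)
  ultimately show ?thesis unfolding computable_def by simp
qed

section \<open>The use of a computation\<close>
definition agree :: "nat \<Rightarrow> cantor \<Rightarrow> cantor \<Rightarrow> bool" where
  "agree n x y \<longleftrightarrow> (\<forall>i<n. x i = y i)"

lemma agree_mono: "agree n x y \<Longrightarrow> m \<le> n \<Longrightarrow> agree m x y"
  by (simp add: agree_def)

definition add_prog :: prog where
  "add_prog = Prec (Proj 0) (Comp Succ [Proj 1])"

lemma eval_Proj': "i < length xs \<Longrightarrow> k = xs ! i \<Longrightarrow> eval z (Proj i) xs k"
  using eval.Proj by blast

lemma eval_add_prog: "eval z add_prog [m, n] (m + n)"
proof (induction m)
  case 0
  then show ?case unfolding add_prog_def by (auto intro!: eval.Prec_0 eval_Proj')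
next
  case (Suc m)
  then show ?case unfolding add_prog_def
    by (auto intro!: eval.Prec_Suc eval.Comp[where ys = "[m + n]"] eval.Succ eval_Proj')
qed

lemma eval_add: "eval z p xs i \<Longrightarrow> eval z q xs j \<Longrightarrow> eval z (Comp add_prog [p, q]) xs (i + j)"
  by (auto intro!: eval.Comp[where ys = "[i, j]"] eval_add_prog)

fun sum_progs :: "prog list \<Rightarrow> prog" where
  "sum_progs [] = Zero"
| "sum_progs (p # ps) = Comp add_prog [p, sum_progs ps]"

lemma eval_sum_progs: "list_all2 (\<lambda>p y. eval z p xs y) ps ys \<Longrightarrow> eval z (sum_progs ps) xs (sum_list ys)"
  by (induction ps ys rule: list_all2_induct) (auto intro: eval.Zero eval_add)

lemma eval_Projs:
  "length xs = m \<Longrightarrow> m + length ys = n \<Longrightarrow>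
    list_all2 (\<lambda>q. eval z q (xs @ ys)) (map Proj [m..<n]) ys"
  by (auto simp: list_all2_conv_all_nth nth_append intro!: eval_Proj')

text \<open>\<open>use_prog a p\<close> retraces the computation of \<open>p\<close> on \<open>a\<close> arguments and adds up the uses of its
  parts. The sum, in place of the maximum, bounds every part and is simpler to program. In the case
  of primitive recursion the accumulated value is the use so far, so the value of the function
  itself has to be computed anew; in the case of minimisation the sum extends over all values that
  have been tried.\<close>
fun use_prog :: "nat \<Rightarrow> prog \<Rightarrow> prog" where
  "use_prog a Oracle = Succ"
| "use_prog a (Comp p qs) = sum_progs (Comp (use_prog (length qs) p) qs # map (use_prog a) qs)"
| "use_prog a (Prec p q) = Prec (use_prog (a - 1) p)
     (Comp add_prog [Proj 1, Comp (use_prog (Suc a) q)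
       (Proj 0 # Comp (Prec p q) (Proj 0 # map Proj [2..<Suc a]) # map Proj [2..<Suc a])])"
| "use_prog a (Mu p) = Comp
     (Prec (Comp (use_prog (Suc a) p) (Zero # map Proj [0..<a]))
       (Comp add_prog [Proj 1, Comp (use_prog (Suc a) p)
         (Comp Succ [Proj 0] # map Proj [2..<Suc (Suc a)])]))
     (Mu p # map Proj [0..<a])"
| "use_prog a _ = Zero"

text \<open>The use is part of the conclusion for \<open>z'\<close> as well: it is a function of the oracle that is
  determined by the initial segment which it measures. The compactness argument below rests on
  this.\<close>
lemma use_principle:
  "eval z p xs k \<Longrightarrow> \<exists>u. \<forall>z'. agree u z z' \<longrightarrow> eval z' p xs k \<and> eval z' (use_prog (length xs) p) xs u"
proof (induction rule: eval.induct)
  case (Zero xs)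
  then show ?case by (auto intro: eval.Zero)
next
  case (Succ n)
  then show ?case by (auto intro: eval.Zero eval.Succ)
next
  case (Proj i xs)
  then show ?case by (auto intro: eval.Zero eval.Proj)
next
  case (Oracle n)
  have "eval z' prog.Oracle [n] (of_bool (z n))" if "agree (Suc n) z z'" for z'
    using eval.Oracle[of z' n] that by (simp add: agree_def)
  then show ?case by (auto intro!: exI[of _ "Suc n"] eval.Succ)
next
  case (Comp xs qs ys p k)
  from Comp.IH(2) obtain u where u: "\<And>z'. agree u z z' \<Longrightarrow>
      eval z' p ys k \<and> eval z' (use_prog (length ys) p) ys u" by blast
  have len: "length ys = length qs"
    using Comp.IH(1) by (simp add: list_all2_lengthD)
  have "\<forall>i<length qs. \<exists>u. \<forall>z'. agree u z z' \<longrightarrow>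
      eval z' (qs ! i) xs (ys ! i) \<and> eval z' (use_prog (length xs) (qs ! i)) xs u"
    using Comp.IH(1) by (auto simp: list_all2_conv_all_nth)
  then obtain v where v: "\<And>i z'. i < length qs \<Longrightarrow> agree (v i) z z' \<Longrightarrow>
      eval z' (qs ! i) xs (ys ! i) \<and> eval z' (use_prog (length xs) (qs ! i)) xs (v i)"
    by metis
  let ?vs = "map v [0..<length qs]"
  show ?case
  proof (intro exI[of _ "sum_list (u # ?vs)"] allI impI)
    fix z' assume agree: "agree (sum_list (u # ?vs)) z z'"
    have u': "agree u z z'" using agree by (rule agree_mono) simp
    have v': "agree (v i) z z'" if "i < length qs" for i
      using agree
    proof (rule agree_mono)
      have "v i \<le> sum_list ?vs" using that by (intro member_le_sum_list) auto
      then show "v i \<le> sum_list (u # ?vs)" by simp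
    qed
    have qs: "list_all2 (\<lambda>q y. eval z' q xs y) qs ys"
      using v v' len by (auto simp: list_all2_conv_all_nth)
    have "eval z' (Comp p qs) xs k"
      using eval.Comp[OF qs] u[OF u'] by blast
    moreover have "list_all2 (\<lambda>q y. eval z' q xs y) (map (use_prog (length xs)) qs) ?vs"
      using v v' by (simp add: list_all2_conv_all_nth)
    then have "list_all2 (\<lambda>q y. eval z' q xs y)
        (Comp (use_prog (length qs) p) qs # map (use_prog (length xs)) qs) (u # ?vs)"
      using eval.Comp[OF qs] u[OF u'] len by simp
    ultimately show "eval z' (Comp p qs) xs k \<and>
        eval z' (use_prog (length xs) (Comp p qs)) xs (sum_list (u # ?vs))"
      using eval_sum_progs by (simp only: use_prog.simps)
  qed
next
  case (Prec_0 p xs k q)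
  then show ?case by (auto intro: eval.Prec_0)
next
  case (Prec_Suc p q n xs r k)
  let ?a = "Suc (length xs)"
  from Prec_Suc.IH(1) obtain u where u: "\<And>z'. agree u z z' \<Longrightarrow>
      eval z' (Prec p q) (n # xs) r \<and> eval z' (use_prog ?a (Prec p q)) (n # xs) u" by auto
  from Prec_Suc.IH(2) obtain v where v: "\<And>z'. agree v z z' \<Longrightarrow>
      eval z' q (n # r # xs) k \<and> eval z' (use_prog (Suc ?a) q) (n # r # xs) v" by auto
  show ?case
  proof (intro exI[of _ "u + v"] allI impI)
    fix z' assume "agree (u + v) z z'"
    then have "agree u z z'" "agree v z z'" by (auto elim: agree_mono)
    note u' = u[OF this(1)] and v' = v[OF this(2)]
    have projs: "list_all2 (\<lambda>q. eval z' q (n # u # xs)) (map Proj [2..<Suc ?a]) xs"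
      using eval_Projs[of "[n, u]" 2 xs "Suc ?a"] by (simp del: upt_Suc)
    have "eval z' (Comp (Prec p q) (Proj 0 # map Proj [2..<Suc ?a])) (n # u # xs) r"
      by (rule eval.Comp[where ys = "n # xs"]) (use projs u' in \<open>auto intro!: eval_Proj' simp del: upt_Suc\<close>)
    then have "eval z' (Comp (use_prog (Suc ?a) q)
       (Proj 0 # Comp (Prec p q) (Proj 0 # map Proj [2..<Suc ?a]) # map Proj [2..<Suc ?a]))
       (n # u # xs) v"
      by (intro eval.Comp[where ys = "n # r # xs"]) (use projs v' in \<open>auto intro!: eval_Proj' simp del: upt_Suc\<close>)
    then have "eval z' (use_prog ?a (Prec p q)) (Suc n # xs) (u + v)"
      unfolding use_prog.simps
      by (intro eval.Prec_Suc[where r = u] eval_add)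
        (use u' in \<open>auto intro!: eval_Proj' simp del: upt_Suc\<close>)
    then show "eval z' (Prec p q) (Suc n # xs) k \<and>
        eval z' (use_prog (length (Suc n # xs)) (Prec p q)) (Suc n # xs) (u + v)"
      using eval.Prec_Suc u' v' by auto
  qed
next
  case (Mu p n xs)
  let ?a = "length xs"
  have "\<forall>m. \<exists>k u. m \<le> n \<longrightarrow> (m < n \<longleftrightarrow> k > 0) \<and> (\<forall>z'. agree u z z' \<longrightarrow>
      eval z' p (m # xs) k \<and> eval z' (use_prog (Suc ?a) p) (m # xs) u)"
  proof
    fix m
    show "\<exists>k u. m \<le> n \<longrightarrow> (m < n \<longleftrightarrow> k > 0) \<and> (\<forall>z'. agree u z z' \<longrightarrow>
      eval z' p (m # xs) k \<and> eval z' (use_prog (Suc ?a) p) (m # xs) u)"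
    proof (cases m n rule: linorder_cases)
      case less
      then obtain k u where "\<forall>z'. agree u z z' \<longrightarrow>
          eval z' p (m # xs) (Suc k) \<and> eval z' (use_prog (length (m # xs)) p) (m # xs) u"
        using Mu.IH(2) by blast
      with less show ?thesis by (intro exI[of _ "Suc k"] exI[of _ u]) auto
    next
      case equal
      from Mu.IH(1) obtain u where "\<forall>z'. agree u z z' \<longrightarrow>
          eval z' p (n # xs) 0 \<and> eval z' (use_prog (length (n # xs)) p) (n # xs) u" by blast
      with equal show ?thesis by (intro exI[of _ 0] exI[of _ u]) auto
    qed auto
  qed
  then obtain k u where k: "\<And>m. m \<le> n \<Longrightarrow> m < n \<longleftrightarrow> k m > 0" and
    u: "\<And>m z'. m \<le> n \<Longrightarrow> agree (u m) z z' \<Longrightarrow>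
      eval z' p (m # xs) (k m) \<and> eval z' (use_prog (Suc ?a) p) (m # xs) (u m)"
    by metis
  show ?case
  proof (intro exI[of _ "\<Sum>m\<le>n. u m"] allI impI)
    fix z' assume agree: "agree (\<Sum>m\<le>n. u m) z z'"
    have u': "eval z' p (m # xs) (k m)" "eval z' (use_prog (Suc ?a) p) (m # xs) (u m)"
      if "m \<le> n" for m
    proof -
      have "u m \<le> (\<Sum>m\<le>n. u m)" using that by (intro member_le_sum) auto
      with agree have "agree (u m) z z'" by (rule agree_mono)
      with u that show "eval z' p (m # xs) (k m)"
        "eval z' (use_prog (Suc ?a) p) (m # xs) (u m)" by blast+
    qed
    have mu: "eval z' (Mu p) xs n"
    proof (rule eval.Mu)
      show "eval z' p (n # xs) 0" using u'(1)[of n] k[of n] by simp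
      show "\<forall>m<n. \<exists>k. eval z' p (m # xs) (Suc k)"
        using u'(1) k by (metis Suc_pred less_imp_le)
    qed
    let ?S = "Prec (Comp (use_prog (Suc ?a) p) (Zero # map Proj [0..<?a]))
       (Comp add_prog [Proj 1, Comp (use_prog (Suc ?a) p)
         (Comp Succ [Proj 0] # map Proj [2..<Suc (Suc ?a)])])"
    have projs0: "list_all2 (\<lambda>q. eval z' q xs) (map Proj [0..<?a]) xs"
      using eval_Projs[of "[]" 0 xs ?a] by (simp del: upt_Suc)
    have "eval z' ?S (m # xs) (\<Sum>j\<le>m. u j)" if "m \<le> n" for m
      using that
    proof (induction m)
      case 0
      have "eval z' (Comp (use_prog (Suc ?a) p) (Zero # map Proj [0..<?a])) xs (u 0)"
        by (rule eval.Comp[where ys = "0 # xs"]) (use projs0 u' in \<open>auto intro: eval.Zero simp del: upt_Suc\<close>)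
      then show ?case by (auto intro: eval.Prec_0)
    next
      case (Suc m)
      let ?r = "\<Sum>j\<le>m. u j"
      have projs: "list_all2 (\<lambda>q. eval z' q (m # ?r # xs)) (map Proj [2..<Suc (Suc ?a)]) xs"
        using eval_Projs[of "[m, ?r]" 2 xs "Suc (Suc ?a)"] by (simp del: upt_Suc)
      have "eval z' (Comp Succ [Proj 0]) (m # ?r # xs) (Suc m)"
        by (rule eval.Comp[where ys = "[m]"]) (auto intro!: eval_Proj' eval.Succ)
      then have "eval z' (Comp (use_prog (Suc ?a) p)
          (Comp Succ [Proj 0] # map Proj [2..<Suc (Suc ?a)])) (m # ?r # xs) (u (Suc m))"
        by (intro eval.Comp[where ys = "Suc m # xs"]) (use projs u'(2)[OF Suc.prems] in \<open>auto simp del: upt_Suc\<close>)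
      then have "eval z' ?S (Suc m # xs) (?r + u (Suc m))"
        using Suc by (intro eval.Prec_Suc[where r = ?r] eval_add) (auto intro!: eval_Proj' simp del: upt_Suc)
      then show ?case by simp
    qed
    then have "eval z' (use_prog ?a (Mu p)) xs (\<Sum>m\<le>n. u m)"
      unfolding use_prog.simps
      by (intro eval.Comp[where ys = "n # xs"]) (use mu projs0 in \<open>auto simp del: upt_Suc\<close>)
    with mu show "eval z' (Mu p) xs n \<and> eval z' (use_prog ?a (Mu p)) xs (\<Sum>m\<le>n. u m)" ..
  qed
qed

section \<open>Finite oracles as arguments\<close>

text \<open>The program \<open>b\<close> answers the queries, and its second argument describes the oracle. That
  argument is passed to all parts of a program as an additional last one, behind the \<open>a\<close>
  arguments proper, because recursion and minimisation insert new arguments in front.\<close>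
fun subst_oracle :: "prog \<Rightarrow> nat \<Rightarrow> prog \<Rightarrow> prog" where
  "subst_oracle b a Zero = Zero"
| "subst_oracle b a Succ = Comp Succ [Proj 0]"
| "subst_oracle b a (Proj i) = Proj i"
| "subst_oracle b a Oracle = b"
| "subst_oracle b a (Comp p qs) =
     Comp (subst_oracle b (length qs) p) (map (subst_oracle b a) qs @ [Proj a])"
| "subst_oracle b a (Prec p q) = Prec (subst_oracle b (a - 1) p) (subst_oracle b (Suc a) q)"
| "subst_oracle b a (Mu p) = Mu (subst_oracle b (Suc a) p)"

lemma eval_subst_oracle:
  assumes "eval x p xs k" and b: "\<And>n. eval z b [n, c] (of_bool (x n))"
  shows "eval z (subst_oracle b (length xs) p) (xs @ [c]) k"
  using assms(1)
proof (induction rule: eval.induct)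
  case (Succ n)
  then show ?case by (auto intro!: eval.Comp[where ys = "[n]"] eval.Succ eval_Proj')
next
  case (Comp xs qs ys p k)
  have "length ys = length qs"
    using Comp.IH(1) by (simp add: list_all2_lengthD)
  with Comp show ?case
    by (auto intro!: eval.Comp[where ys = "ys @ [c]"] list_all2_appendI eval_Proj'
        simp: list_all2_conv_all_nth)
next
  case (Mu p n xs)
  then show ?case by (auto intro!: eval.Mu)
qed (use b in \<open>auto intro: eval.intros eval_Proj' simp: nth_append\<close>)

text \<open>The binary digits of a number form an oracle that is eventually 0, and all finite oracles arise
  in this way.\<close>
lemma computable_from_finite_oracle:
  assumes p: "\<And>x n. eval x p [n] (F x n)"
    and A: "computable Z a A" and B: "computable Z a B"
  shows "computable Z a (\<lambda>z e. F (bit (A z e)) (B z e))"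
proof (rule computable_compose2[OF _ A B])
  have "decidable Z 2 (\<lambda>z e. bit (e 1) (e 0))"
    by (intro computable_intros) simp_all
  then obtain b where b: "\<And>z e. z \<in> Z \<Longrightarrow> eval z b (map e [0..<2]) (of_bool (bit (e 1) (e 0)))"
    unfolding computable_def by blast
  have b': "eval z b [n, c] (of_bool (bit c n))" if "z \<in> Z" for z n c
    using b[OF that, of "case_nat n (\<lambda>_. c)"] by (simp add: upt_rec)
  have "eval z (subst_oracle b 1 p) [n, c] (F (bit c) n)" if "z \<in> Z" for z n c
    using eval_subst_oracle[OF p b'[OF that]] by simp
  then have "eval z (Comp (subst_oracle b 1 p) [Proj 1, Proj 0]) (map e [0..<2]) (F (bit (e 0)) (e 1))"
    if "z \<in> Z" for z e
    using that by (intro eval.Comp[where ys = "[e 1, e 0]"]) (auto intro!: eval_Proj')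
  then show "computable Z 2 (\<lambda>z e. F (bit (e 0)) (e 1))"
    unfolding computable_def by blast
qed


section \<open>Strings as numbers, and compactness\<close>

text \<open>A string of length \<open>n\<close> is represented by the number below \<open>2 ^ n\<close> with these binary digits, the
  first bit being the least significant one. Then \<open>bit\<close> extends a string by zeros and
  \<open>take_bit\<close> truncates it.\<close>
definition prefix_code :: "cantor \<Rightarrow> nat \<Rightarrow> nat" where
  "prefix_code x n = (\<Sum>i<n. of_bool (x i) * 2 ^ i)"

lemma bit_prefix: "bit (prefix_code x n) i \<longleftrightarrow> i < n \<and> x i"
proof -
  have "prefix_code x n = horner_sum of_bool 2 (map x [0..<n])"
    by (simp add: prefix_code_def horner_sum_eq_sum atLeast0LessThan)
  then show ?thesis by (simp add: bit_horner_sum_bit_iff cong: conj_cong)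
qed

lemma prefix_0 [simp]: "prefix_code x 0 = 0"
  by (simp add: prefix_code_def)

lemma prefix_Suc: "prefix_code x (Suc n) = prefix_code x n + of_bool (x n) * 2 ^ n"
  by (simp add: prefix_code_def)

lemma prefix_less: "prefix_code x n < 2 ^ n"
proof (induction n)
  case (Suc n)
  have "of_bool (x n) * 2 ^ n \<le> (2::nat) ^ n" by simp
  with Suc show ?case unfolding prefix_Suc by simp
qed simp

lemma prefix_eq_iff: "prefix_code x n = prefix_code y n \<longleftrightarrow> agree n x y"
  by (auto simp: bit_eq_iff bit_prefix agree_def)

lemma prefix_bit: "prefix_code (bit t) n = take_bit n t"
  by (rule bit_eqI) (auto simp: bit_prefix bit_take_bit_iff)

lemma prefix_bit_prefix: "m \<le> n \<Longrightarrow> prefix_code (bit (prefix_code x n)) m = prefix_code x m"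
  by (auto simp: prefix_eq_iff agree_def bit_prefix)

text \<open>Compactness of Cantor space: if \<open>w\<close> were unbounded, it would be unbounded on one half of the
  space, on one half of that half, and so on. But \<open>w\<close> is constant near the sequence on which
  these halves close down.\<close>
lemma locally_constant_bounded:
  fixes w :: "cantor \<Rightarrow> nat"
  assumes w: "\<And>x y. agree (w x) x y \<Longrightarrow> w y = w x"
  shows "\<exists>m. \<forall>x. w x \<le> m"
proof (rule ccontr)
  assume unbounded: "\<nexists>m. \<forall>x. w x \<le> m"
  define unb where "unb l x \<longleftrightarrow> (\<forall>m. \<exists>y. agree l x y \<and> m < w y)" for l x
  have "\<exists>s. \<forall>l. unb l (s l) \<and> agree l (s l) (s (Suc l))"
  proof (rule dependent_nat_choice)
    show "\<exists>x. unb 0 x" using unbounded by (auto simp: unb_def agree_def not_le)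
  next
    fix x l assume x: "unb l x"
    show "\<exists>y. unb (Suc l) y \<and> agree l x y"
    proof (rule ccontr)
      assume "\<not> ?thesis"
      then have "\<not> unb (Suc l) (x(l := b))" for b
        by (auto simp: agree_def)
      then obtain m where m: "\<And>b y. agree (Suc l) (x(l := b)) y \<Longrightarrow> w y \<le> m b"
        unfolding unb_def not_all not_ex de_Morgan_conj not_less by metis
      from x obtain y where y: "agree l x y" "max (m True) (m False) < w y"
        unfolding unb_def by blast
      from y(1) have "agree (Suc l) (x(l := y l)) y" by (auto simp: agree_def less_Suc_eq)
      from m[OF this] y(2) show False by (cases "y l") auto
    qed
  qed
  then obtain s where s: "\<And>l. unb l (s l)" "\<And>l. agree l (s l) (s (Suc l))" by blast
  define x where "x i = s (Suc i) i" for i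
  have "s l i = x i" if "i < l" for i l
    using that
  proof (induction l)
    case (Suc l)
    then show ?case using s(2)[of l] by (cases "i = l") (auto simp: agree_def x_def)
  qed simp
  then have "agree l (s l) x" for l by (simp add: agree_def)
  then have unb: "unb l x" for l using s(1)[of l] by (auto simp: unb_def agree_def)
  from unb[of "w x"] obtain y where "agree (w x) x y" "w x < w y"
    unfolding unb_def by blast
  with w[of x y] show False by simp
qed

section \<open>The measure of clopen sets\<close>
interpretation cantor: prob_space cantor_measure
  unfolding cantor_measure_def
  by (intro prob_space_PiM measure_pmf.prob_space_axioms)

lemma space_cantor_measure [simp]: "space cantor_measure = UNIV"
  by (simp add: cantor_measure_def space_PiM)

lemma measurable_nth_bit [measurable]: "(\<lambda>y. y i) \<in> measurable cantor_measure (count_space UNIV)"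
proof -
  have "(\<lambda>y. y i) \<in> measurable cantor_measure (measure_pmf (bernoulli_pmf (1/2)))"
    unfolding cantor_measure_def by (rule measurable_component_singleton) simp
  then show ?thesis by simp
qed

lemma measurable_prefix [measurable]: "(\<lambda>y. prefix_code y n) \<in> measurable cantor_measure (count_space UNIV)"
  unfolding prefix_code_def by measurable

lemma sets_prefix [measurable]: "{y. P (prefix_code y n)} \<in> sets cantor_measure"
proof -
  have "{y \<in> space cantor_measure. P (prefix_code y n)} \<in> sets cantor_measure" by measurable
  then show ?thesis by simp
qed

lemma measure_prefix_eq:
  assumes "t < 2 ^ n"
  shows "measure cantor_measure {y. prefix_code y n = t} = 1 / 2 ^ n"
proof -
  interpret P: product_prob_space "\<lambda>_::nat. measure_pmf (bernoulli_pmf (1/2))" UNIV ..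
  let ?E = "prod_emb UNIV (\<lambda>_. measure_pmf (bernoulli_pmf (1/2))) {..<n} (\<Pi>\<^sub>E i\<in>{..<n}. {bit t i})"
  have "t = prefix_code (bit t) n" using assms by (simp add: prefix_bit take_bit_nat_eq_self)
  then have "prefix_code y n = t \<longleftrightarrow> agree n y (bit t)" for y
    by (metis prefix_eq_iff)
  then have "{y. prefix_code y n = t} = ?E"
    by (auto simp: prod_emb_def agree_def PiE_def restrict_def extensional_def)
  moreover have "measure cantor_measure ?E = (\<Prod>i<n. measure (measure_pmf (bernoulli_pmf (1/2))) {bit t i})"
    unfolding cantor_measure_def by (rule P.measure_PiM_emb) auto
  moreover have "measure (measure_pmf (bernoulli_pmf (1/2))) {b} = 1/2" for b
    by (cases b) (simp_all add: measure_pmf_single)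
  ultimately show ?thesis by (simp add: power_one_over)
qed

lemma measure_prefix:
  "measure cantor_measure {y. P (prefix_code y n)} = (\<Sum>t<2^n. of_bool (P t)) / 2 ^ n"
proof -
  have "{y. P (prefix_code y n)} = (\<Union>t\<in>{t. t < 2 ^ n \<and> P t}. {y. prefix_code y n = t})"
    using prefix_less by auto
  also have "measure cantor_measure \<dots> =
      (\<Sum>t\<in>{t. t < 2 ^ n \<and> P t}. measure cantor_measure {y. prefix_code y n = t})"
    by (rule cantor.finite_measure_finite_Union) (auto simp: disjoint_family_on_def sets_prefix)
  also have "\<dots> = (\<Sum>t\<in>{t. t < 2 ^ n \<and> P t}. 1 / 2 ^ n)"
    by (intro sum.cong) (auto simp: measure_prefix_eq)
  also have "\<dots> = (\<Sum>t<2^n. of_bool (P t)) / 2 ^ n"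
    by (simp add: sum_of_bool_eq Collect_conj_eq lessThan_def)
  finally show ?thesis .
qed

section \<open>Stages and their limits\<close>
lemma computable_prefix:
  assumes "decidable Z (Suc a) (\<lambda>z e. X z (e 0) (\<lambda>j. e (Suc j)))" "computable Z a N"
  shows "computable Z a (\<lambda>z e. prefix_code (\<lambda>i. X z i e) (N z e))"
  unfolding prefix_code_def by (intro computable_intros assms) simp

text \<open>All that the construction needs to know about a program for \<open>f\<close>: a use function \<open>u\<close> that is
  determined by the part of the oracle which it bounds, and the computability of \<open>f\<close> and \<open>u\<close> on
  finite oracles. The parameter \<open>c\<close> fixes the measure of the set on which the inversion may fail.\<close>
locale functional_with_use =
  fixes f :: "cantor \<Rightarrow> cantor" and u :: "cantor \<Rightarrow> nat \<Rightarrow> nat" and c :: nat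
  assumes use: "agree (u x n) x y \<Longrightarrow> f y n = f x n \<and> u y n = u x n"
    and computable_f: "computable Z a A \<Longrightarrow> computable Z a B \<Longrightarrow>
      computable Z a (\<lambda>z e. of_bool (f (bit (A z e)) (B z e)))"
    and computable_u: "computable Z a A \<Longrightarrow> computable Z a B \<Longrightarrow>
      computable Z a (\<lambda>z e. u (bit (A z e)) (B z e))"
begin

text \<open>A modulus of continuity for \<open>f\<close>. It only inspects oracles of length \<open>m\<close>, but a computation
  with such an oracle and use at most \<open>m\<close> is the computation for every extension of it.\<close>
definition use_bound :: "nat \<Rightarrow> nat" where
  "use_bound n = (LEAST m. \<forall>t<2 ^ m. \<forall>i<n. u (bit (t :: nat)) i \<le> m)"

lemma use_bound_ex: "\<exists>m. \<forall>t<2 ^ m. \<forall>i<n. u (bit (t :: nat)) i \<le> m"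
proof -
  have "\<exists>m. \<forall>x. (\<Sum>i<n. u x i) \<le> m"
  proof (rule locally_constant_bounded)
    fix x y assume *: "agree (\<Sum>i<n. u x i) x y"
    have "u y i = u x i" if "i < n" for i
      using use[OF agree_mono[OF *]] member_le_sum[of i "{..<n}" "u x"] that by simp
    then show "(\<Sum>i<n. u y i) = (\<Sum>i<n. u x i)" by simp
  qed
  then obtain m where m: "\<And>x. (\<Sum>i<n. u x i) \<le> m" by blast
  have "u x i \<le> m" if "i < n" for x i
    using member_le_sum[of i "{..<n}" "u x"] m[of x] that by simp
  then show ?thesis by blast
qed

lemma agree_use_bound:
  assumes "agree (use_bound n) x y" "i < n"
  shows "f x i = f y i"
proof -
  have *: "f (bit (prefix_code x (use_bound n))) i = f x i" for x
  proof -
    have "u (bit (prefix_code x (use_bound n))) i \<le> use_bound n"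
      using LeastI_ex[OF use_bound_ex[of n]] prefix_less assms(2) unfolding use_bound_def by blast
    moreover have "agree (use_bound n) (bit (prefix_code x (use_bound n))) x"
      by (simp add: agree_def bit_prefix)
    ultimately have "agree (u (bit (prefix_code x (use_bound n))) i) (bit (prefix_code x (use_bound n))) x"
      by (rule agree_mono[rotated])
    from use[OF this] show ?thesis by simp
  qed
  have "prefix_code x (use_bound n) = prefix_code y (use_bound n)"
    using assms(1) by (simp add: prefix_eq_iff)
  then show ?thesis using *[of x] *[of y] by simp
qed

lemma computable_use_bound: "computable Z a F \<Longrightarrow> computable Z a (\<lambda>z e. use_bound (F z e))"
proof (rule computable_compose1[where F = "\<lambda>z. use_bound"])
  show "computable Z 1 (\<lambda>z e. use_bound (e 0))"
    unfolding use_bound_def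
    by (intro computable_Least computable_intros computable_u use_bound_ex) simp_all
qed

text \<open>Some sequence that extends the string \<open>s\<close> of length \<open>l\<close> has an image that extends the string
  \<open>t\<close> of length \<open>n\<close>.\<close>
definition reach :: "nat \<Rightarrow> nat \<Rightarrow> nat \<Rightarrow> nat \<Rightarrow> bool" where
  "reach l s n t \<longleftrightarrow> (\<exists>x. prefix_code x l = s \<and> prefix_code (f x) n = t)"

text \<open>The modulus of continuity reduces the quantifier over all sequences to a bounded one.\<close>
lemma reach_iff:
  "reach l s n t \<longleftrightarrow> (\<exists>r<2 ^ (use_bound n + l). take_bit l r = s \<and> prefix_code (f (bit r)) n = t)"
proof
  assume "reach l s n t"
  then obtain x where x: "prefix_code x l = s" "prefix_code (f x) n = t" unfolding reach_def by blast
  let ?r = "prefix_code x (use_bound n + l)"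
  have "agree (use_bound n) (bit ?r) x" by (simp add: agree_def bit_prefix)
  then have "prefix_code (f (bit ?r)) n = t"
    unfolding x(2)[symmetric] prefix_eq_iff using agree_use_bound by (simp add: agree_def)
  moreover have "take_bit l ?r = s"
    using x(1) by (simp add: prefix_bit[symmetric] prefix_bit_prefix)
  ultimately show "\<exists>r<2 ^ (use_bound n + l). take_bit l r = s \<and> prefix_code (f (bit r)) n = t"
    using prefix_less by blast
next
  assume "\<exists>r<2 ^ (use_bound n + l). take_bit l r = s \<and> prefix_code (f (bit r)) n = t"
  then show "reach l s n t" unfolding reach_def by (metis prefix_bit)
qed

lemma decidable_reach:
  assumes "computable Z a A" "computable Z a B" "computable Z a C" "computable Z a D"
  shows "decidable Z a (\<lambda>z e. reach (A z e) (B z e) (C z e) (D z e))"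
proof (rule computable_compose4[where F = "\<lambda>z l s n t. of_bool (reach l s n t)", OF _ assms])
  show "decidable Z 4 (\<lambda>z e. reach (e 0) (e 1) (e 2) (e 3))"
    unfolding reach_iff
    by (intro computable_intros computable_use_bound computable_prefix computable_f) simp_all
qed

text \<open>The clopen neighbourhood of \<open>f([s])\<close> that consists of all sequences which agree with an element of
  \<open>f([s])\<close> up to position \<open>n\<close>, and the intersection of these neighbourhoods, the closure of
  \<open>f([s])\<close>.\<close>
definition stage :: "nat \<Rightarrow> nat \<Rightarrow> nat \<Rightarrow> cantor set" where
  "stage l s n = {y. reach l s n (prefix_code y n)}"

definition limit :: "nat \<Rightarrow> nat \<Rightarrow> cantor set" where
  "limit l s = (\<Inter>n. stage l s n)"

text \<open>The total measure of the stages for all strings of length \<open>l\<close>, in units of \<open>2 ^ -n\<close>.\<close>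
definition stage_count :: "nat \<Rightarrow> nat \<Rightarrow> nat" where
  "stage_count l n = (\<Sum>s<2 ^ l. \<Sum>t<2 ^ n. of_bool (reach l s n t))"

lemma sets_stage [measurable, simp]: "stage l s n \<in> sets cantor_measure"
  unfolding stage_def by (rule sets_prefix)

lemma sets_limit [measurable, simp]: "limit l s \<in> sets cantor_measure"
  unfolding limit_def by (intro sets.countable_INT) auto

lemma reach_prefix_mono:
  assumes "m \<le> n" "reach l s n (prefix_code y n)"
  shows "reach l s m (prefix_code y m)"
proof -
  from assms(2) obtain x where x: "prefix_code x l = s" "agree n (f x) y"
    unfolding reach_def prefix_eq_iff by blast
  from agree_mono[OF x(2) assms(1)] x(1) show ?thesis
    unfolding reach_def prefix_eq_iff by blast
qed

lemma decseq_stage: "decseq (stage l s)"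
  by (auto simp: decseq_def stage_def intro: reach_prefix_mono)

lemma stage_count_eq: "real (stage_count l n) / 2 ^ n = (\<Sum>s<2 ^ l. measure cantor_measure (stage l s n))"
proof -
  have "measure cantor_measure (stage l s n) = (\<Sum>t<2 ^ n. of_bool (reach l s n t)) / 2 ^ n" for s
    unfolding stage_def by (rule measure_prefix)
  then show ?thesis by (simp add: stage_count_def sum_divide_distrib)
qed

text \<open>Continuity of the measure from above.\<close>
lemma stage_count_tendsto:
  "(\<lambda>n. real (stage_count l n) / 2 ^ n) \<longlonglongrightarrow> (\<Sum>s<2 ^ l. measure cantor_measure (limit l s))"
  unfolding stage_count_eq limit_def
  by (intro tendsto_sum cantor.finite_Lim_measure_decseq decseq_stage) auto

lemma stage_count_ge: "(\<Sum>s<2 ^ l. measure cantor_measure (limit l s)) \<le> real (stage_count l n) / 2 ^ n"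
  unfolding stage_count_eq by (intro sum_mono cantor.finite_measure_mono) (auto simp: limit_def)

section \<open>Settled stages\<close>

text \<open>Between the stages \<open>n\<close> and \<open>t\<close> the total measure drops by at least \<open>2 ^ -(l + c)\<close>. The
  inequality is multiplied out so that it is decidable as one between natural numbers.\<close>
definition drops :: "nat \<Rightarrow> nat \<Rightarrow> nat \<Rightarrow> bool" where
  "drops t l n \<longleftrightarrow>
     stage_count l t * 2 ^ n * 2 ^ (l + c) + 2 ^ (n + t) \<le> stage_count l n * 2 ^ t * 2 ^ (l + c)"

lemma drops_iff:
  "drops t l n \<longleftrightarrow> real (stage_count l t) / 2 ^ t + 1 / 2 ^ (l + c) \<le> real (stage_count l n) / 2 ^ n"
proof -
  have "drops t l n \<longleftrightarrow> real (stage_count l t * 2 ^ n * 2 ^ (l + c) + 2 ^ (n + t))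
      \<le> real (stage_count l n * 2 ^ t * 2 ^ (l + c))"
    unfolding drops_def by (rule of_nat_le_iff[symmetric])
  also have "\<dots> \<longleftrightarrow> real (stage_count l t) / 2 ^ t + 1 / 2 ^ (l + c) \<le> real (stage_count l n) / 2 ^ n"
    by (simp add: field_simps power_add)
  finally show ?thesis .
qed

definition settled :: "nat \<Rightarrow> nat" where
  "settled l = (LEAST n. \<not> (\<exists>t. drops t l n))"

text \<open>The total measure converges and never falls below its limit, so from some stage on there is no
  room for a drop.\<close>
lemma settled_ex: "\<exists>n. \<not> (\<exists>t. drops t l n)"
proof -
  let ?L = "\<Sum>s<2 ^ l. measure cantor_measure (limit l s)"
  have "\<forall>\<^sub>F n in sequentially. real (stage_count l n) / 2 ^ n < ?L + 1 / 2 ^ (l + c)"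
    by (rule order_tendstoD(2)[OF stage_count_tendsto]) simp
  then obtain n where n: "real (stage_count l n) / 2 ^ n < ?L + 1 / 2 ^ (l + c)"
    by (meson eventually_happens trivial_limit_sequentially)
  then have "\<not> drops t l n" for t
    using stage_count_ge[of l t] unfolding drops_iff by linarith
  then show ?thesis by blast
qed

lemma stage_count_settled_le:
  "real (stage_count l (settled l)) / 2 ^ settled l
     \<le> (\<Sum>s<2 ^ l. measure cantor_measure (limit l s)) + 1 / 2 ^ (l + c)"
proof (rule tendsto_lowerbound[OF tendsto_add[OF stage_count_tendsto tendsto_const]])
  have "\<not> drops t l (settled l)" for t
    using LeastI_ex[OF settled_ex[of l]] unfolding settled_def by blast
  then show "\<forall>\<^sub>F t in sequentially. real (stage_count l (settled l)) / 2 ^ settled l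
      \<le> real (stage_count l t) / 2 ^ t + 1 / 2 ^ (l + c)"
    unfolding drops_iff by (auto intro!: always_eventually simp: not_le intro: less_imp_le)
qed simp

text \<open>The sequences for which some test at level \<open>l\<close> would give the wrong answer.\<close>
definition bad :: "nat \<Rightarrow> cantor set" where
  "bad l = (\<Union>s<2 ^ l. stage l s (settled l) - limit l s)"

lemma sets_bad [measurable, simp]: "bad l \<in> sets cantor_measure"
  unfolding bad_def by measurable

lemma measure_bad_le: "measure cantor_measure (bad l) \<le> 1 / 2 ^ (l + c)"
proof -
  have "measure cantor_measure (bad l)
      \<le> (\<Sum>s<2 ^ l. measure cantor_measure (stage l s (settled l) - limit l s))"
    unfolding bad_def by (rule cantor.finite_measure_subadditive_finite) auto
  also have "\<dots> = (\<Sum>s<2 ^ l. measure cantor_measure (stage l s (settled l))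
      - measure cantor_measure (limit l s))"
    by (intro sum.cong refl cantor.finite_measure_Diff) (auto simp: limit_def)
  also have "\<dots> \<le> 1 / 2 ^ (l + c)"
    using stage_count_settled_le[of l] by (simp add: sum_subtractf stage_count_eq)
  finally show ?thesis .
qed

lemma measure_UN_bad_le: "measure cantor_measure (\<Union>l. bad l) \<le> 2 / 2 ^ c"
proof -
  have sums: "(\<lambda>l. 1 / 2 ^ (l + c) :: real) sums (2 / 2 ^ c)"
    using sums_mult2[OF geometric_sums[of "1/2::real"], of "1 / 2 ^ c"]
    by (simp add: power_add power_one_over)
  have "summable (\<lambda>l. measure cantor_measure (bad l))"
    by (rule summable_comparison_test'[OF sums_summable[OF sums], of 0]) (simp add: measure_bad_le)
  then have "measure cantor_measure (\<Union>l. bad l) \<le> (\<Sum>l. measure cantor_measure (bad l))"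
    by (intro cantor.finite_measure_subadditive_countably) auto
  also have "\<dots> \<le> (\<Sum>l. 1 / 2 ^ (l + c))"
    by (intro suminf_le measure_bad_le \<open>summable _\<close> sums_summable[OF sums])
  also have "\<dots> = 2 / 2 ^ c" using sums by (rule sums_unique[symmetric])
  finally show ?thesis .
qed

section \<open>The inversion\<close>

text \<open>The leftmost path through the strings that pass the test. The right successor is taken without a
  test: if it is wrong as well, there is no preimage or \<open>y\<close> is bad. This keeps the inversion
  total.\<close>
primrec branch :: "cantor \<Rightarrow> nat \<Rightarrow> nat" where
  "branch y 0 = 0"
| "branch y (Suc l) =
     (if y \<in> stage (Suc l) (branch y l) (settled (Suc l)) then branch y l else branch y l + 2 ^ l)"

definition inversion :: "cantor \<Rightarrow> cantor" where
  "inversion y l = bit (branch y (Suc l)) l"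

lemma branch_less: "branch y l < 2 ^ l"
  by (induction l) auto

lemma prefix_inversion: "prefix_code (inversion y) l = branch y l"
proof (induction l)
  case (Suc l)
  have "\<not> bit (branch y l) l"
    using branch_less[of y l] by (simp add: bit_iff_odd)
  moreover have "bit (branch y l + 2 ^ l) l"
    using branch_less[of y l] by (simp add: bit_iff_odd div_add_self2)
  ultimately show ?case by (simp add: prefix_Suc Suc) (simp add: inversion_def)
qed simp

text \<open>If \<open>y\<close> left the limits of both successors, it would leave them at two finite stages, and hence at
  the larger of these stages. But at that stage a sequence extending \<open>s\<close> is still a witness, and it
  extends one of the successors.\<close>
lemma limit_subset: "limit l s \<subseteq> limit (Suc l) s \<union> limit (Suc l) (s + 2 ^ l)"
proof
  fix y assume y: "y \<in> limit l s"
  show "y \<in> limit (Suc l) s \<union> limit (Suc l) (s + 2 ^ l)"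
  proof (rule ccontr)
    assume "\<not> ?thesis"
    then obtain m n where mn: "y \<notin> stage (Suc l) s m" "y \<notin> stage (Suc l) (s + 2 ^ l) n"
      by (auto simp: limit_def)
    have "y \<in> stage l s (max m n)" using y by (simp add: limit_def)
    then obtain x where x: "prefix_code x l = s" "prefix_code (f x) (max m n) = prefix_code y (max m n)"
      by (auto simp: stage_def reach_def)
    then have "y \<in> stage (Suc l) (prefix_code x (Suc l)) (max m n)"
      by (auto simp: stage_def reach_def)
    moreover have "prefix_code x (Suc l) = s \<or> prefix_code x (Suc l) = s + 2 ^ l"
      by (simp add: prefix_Suc x(1))
    ultimately have "y \<in> stage (Suc l) s (max m n) \<or> y \<in> stage (Suc l) (s + 2 ^ l) (max m n)"
      by auto
    with mn show False
      using decseqD[OF decseq_stage] by (metis max.cobounded1 max.cobounded2 subsetD)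
  qed
qed

text \<open>The path never leaves the strings \<open>s\<close> with \<open>y\<close> in the limit for \<open>s\<close>. So every initial segment of
  the path extends to a sequence whose image agrees with \<open>y\<close> as far as desired, and by continuity
  the image of the path itself agrees with \<open>y\<close>.\<close>
lemma inversion_correct:
  assumes y: "y \<in> range f" "y \<notin> (\<Union>l. bad l)"
  shows "f (inversion y) = y"
proof
  fix i
  have limit: "y \<in> limit l (branch y l)" for l
  proof (induction l)
    case 0
    from y(1) show ?case by (auto simp: limit_def stage_def reach_def)
  next
    case (Suc l)
    have "branch y l < 2 ^ Suc l" using branch_less[of y l] by simp
    then have "y \<in> limit (Suc l) (branch y l)" if "y \<in> stage (Suc l) (branch y l) (settled (Suc l))"
      using y(2) that by (auto simp: bad_def)
    moreover have "limit (Suc l) (branch y l) \<subseteq> stage (Suc l) (branch y l) (settled (Suc l))"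
      by (auto simp: limit_def)
    ultimately show ?case using Suc.IH limit_subset[of l "branch y l"] by auto
  qed
  have "y \<in> stage (use_bound (Suc i)) (branch y (use_bound (Suc i))) (Suc i)"
    using limit by (auto simp: limit_def)
  then obtain x where x: "agree (use_bound (Suc i)) (inversion y) x" "agree (Suc i) (f x) y"
    unfolding stage_def reach_def prefix_inversion[symmetric] prefix_eq_iff
    by (auto simp: agree_def)
  from agree_use_bound[OF x(1), of i] x(2) show "f (inversion y) i = y i"
    by (simp add: agree_def)
qed

text \<open>Each bit of \<open>f (inversion y)\<close> is a function of finitely many steps of the path.\<close>
lemma sets_inversion_correct: "{y. f (inversion y) = y} \<in> sets cantor_measure"
proof -
  have [measurable]: "(\<lambda>y. branch y l) \<in> measurable cantor_measure (count_space UNIV)" for l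
  proof (induction l)
    case (Suc l)
    have "(\<lambda>y. if y \<in> stage (Suc l) r (settled (Suc l)) then r else r + 2 ^ l)
        \<in> measurable cantor_measure (count_space UNIV)" for r
      by measurable
    from measurable_compose_countable[OF this Suc] show ?case by simp
  qed simp
  have "f (inversion y) i = f (bit (branch y (use_bound (Suc i)))) i" for y i
    by (rule agree_use_bound[of "Suc i"]) (simp_all add: prefix_inversion[symmetric] agree_def bit_prefix)
  then have "{y. f (inversion y) = y} =
      {y \<in> space cantor_measure. \<forall>i. f (bit (branch y (use_bound (Suc i)))) i = y i}"
    by (auto simp: fun_eq_iff)
  also have "\<dots> \<in> sets cantor_measure" by measurable
  finally show ?thesis .
qed

lemma computable_stage_count:
  "computable Z a A \<Longrightarrow> computable Z a B \<Longrightarrow> computable Z a (\<lambda>z e. stage_count (A z e) (B z e))"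
proof (rule computable_compose2[where F = "\<lambda>z. stage_count"])
  show "computable Z 2 (\<lambda>z e. stage_count (e 0) (e 1))"
    unfolding stage_count_def by (intro computable_intros decidable_reach) simp_all
qed

text \<open>The sequence \<open>y\<close> is the even part of the oracle, and the halting problem, the odd part, is
  queried only to find the settled stages. The search for these terminates because the odd part is
  the halting problem.\<close>
lemma computable_inversion:
  assumes Z: "Z = range (\<lambda>y. y \<oplus>\<^sub>T halting_problem)"
  shows "decidable Z 1 (\<lambda>z e. inversion (\<lambda>i. z (2 * i)) (e 0))"
proof -
  have "decidable UNIV 3 (\<lambda>z e. drops (e 0) (e 1) (e 2))"
    unfolding drops_def by (intro computable_intros computable_stage_count) simp_all
  note drops = decidable_ex_in_halting_problem[where Q = drops, OF this _ _ Z]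
  have settled: "computable Z a F \<Longrightarrow> computable Z a (\<lambda>z e. settled (F z e))" for a F
  proof (rule computable_compose1[where F = "\<lambda>z. settled"])
    show "computable Z 1 (\<lambda>z e. settled (e 0))"
      unfolding settled_def by (intro computable_Least computable_intros drops settled_ex) simp_all
  qed
  have branch_rec: "branch y l = rec_nat 0 (\<lambda>l s. if reach (Suc l) s (settled (Suc l))
      (prefix_code y (settled (Suc l))) then s else s + 2 ^ l) l" for y l
    by (induction l) (auto simp: stage_def)
  show ?thesis
    unfolding inversion_def branch_rec
    by (intro computable_intros computable_rec_nat decidable_reach settled computable_prefix
        decidable_oracle) simp_all
qed

lemma partial_computable_inversion:
  "partial_computable_in halting_problem (\<lambda>y. Some (inversion y))"
proof -
  obtain p where p: "\<And>y e. eval (y \<oplus>\<^sub>T halting_problem) p (map e [0..<1])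
      (of_bool (inversion (\<lambda>i. (y \<oplus>\<^sub>T halting_problem) (2 * i)) (e 0)))"
    using computable_inversion[OF refl] unfolding computable_def by blast
  have "eval (y \<oplus>\<^sub>T halting_problem) p [n] (of_bool (inversion y n))" for y n
    using p[of y "\<lambda>_. n"] by (simp add: join_def)
  then show ?thesis
    unfolding partial_computable_in_def halts_def by (intro exI[of _ p]) auto
qed

lemma measure_inversion_correct_ge:
  assumes "range f \<in> sets cantor_measure"
  shows "measure cantor_measure {y. f (inversion y) = y} \<ge> measure cantor_measure (range f) - 2 / 2 ^ c"
proof -
  have "measure cantor_measure (range f)
      \<le> measure cantor_measure ({y. f (inversion y) = y} \<union> (\<Union>l. bad l))"
    using inversion_correct sets_inversion_correct
    by (intro cantor.finite_measure_mono sets.Un sets.countable_UN) auto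
  also have "\<dots> \<le> measure cantor_measure {y. f (inversion y) = y} + measure cantor_measure (\<Union>l. bad l)"
    by (intro measure_Un_le sets_inversion_correct sets.countable_UN) auto
  finally show ?thesis using measure_UN_bad_le by simp
qed

end

theorem theorem2p9:
  fixes f :: "cantor \<Rightarrow> cantor"
  assumes "total_computable f"
    and "measure cantor_measure (range f) > 0"
  shows "\<exists>g. partial_computable_in halting_problem g \<and>
    measure cantor_measure {y. \<exists>x. g y = Some x \<and> f x = y} > 0"
proof -
  from assms(1) obtain p where p: "\<And>x n. eval x p [n] (of_bool (f x n))"
    unfolding total_computable_def by blast
  have "\<forall>x n. \<exists>u. \<forall>y. agree u x y \<longrightarrow>
      eval y p [n] (of_bool (f x n)) \<and> eval y (use_prog 1 p) [n] u"
    using use_principle[OF p] by simp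
  then obtain u where u: "\<And>x n y. agree (u x n) x y \<Longrightarrow>
      eval y p [n] (of_bool (f x n)) \<and> eval y (use_prog 1 p) [n] (u x n)"
    by metis
  have u': "eval x (use_prog 1 p) [n] (u x n)" for x n
    using u[of x n x] by (simp add: agree_def)
  \<comment> \<open>The errors of all levels have total measure at most \<open>2 / 2 ^ c\<close>.\<close>
  obtain c where c: "2 / 2 ^ c < measure cantor_measure (range f)"
  proof -
    obtain c where "(1/2::real) ^ c < measure cantor_measure (range f) / 2"
      using assms(2) real_arch_pow_inv[of "measure cantor_measure (range f) / 2" "1/2"] by auto
    then show ?thesis by (intro that[of c]) (simp add: power_one_over field_simps)
  qed
  interpret functional_with_use f u c
  proof
    fix x y n assume "agree (u x n) x y"
    then have "eval y p [n] (of_bool (f x n))" "eval y (use_prog 1 p) [n] (u x n)"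
      using u by blast+
    with p[of y n] u'[of y n] have "of_bool (f y n) = (of_bool (f x n) :: nat)" "u y n = u x n"
      using eval_deterministic by blast+
    then show "f y n = f x n \<and> u y n = u x n" by (simp add: of_bool_eq_iff)
  qed (use computable_from_finite_oracle[OF p] computable_from_finite_oracle[OF u'] in blast)+
  \<comment> \<open>A set that is not measurable has measure 0 by definition.\<close>
  have "range f \<in> sets cantor_measure"
    using assms(2) measure_notin_sets by fastforce
  from measure_inversion_correct_ge[OF this] c
  have "measure cantor_measure {y. f (inversion y) = y} > 0" by linarith
  with partial_computable_inversion show ?thesis
    by (intro exI[of _ "\<lambda>y. Some (inversion y)"]) simp
qed

end
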